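(* If $M=M_0\oplus M_2\in\mathcal{T}$, then the space $M_2$ with the product $x\star y=(xy)_2$ is a Malcev algebra.
   Context: $k$ is a field of characteristic $\neq 2,3$. Let $\Lambda=\Lambda_0\oplus\Lambda_2$, $\Lambda_0=ka$, $\Lambda_2=kv\oplus kw$, be the commutative $k$-algebra with $a^2=a$, $av=v$, $aw=w$, $v^2=(v+2a)/3$, $w^2=(w+2a)/3$, $vw=-(v+w+a)/3$. For an algebra $M$ with a vector space decomposition $M=M_0\oplus M_2$, $(m)_0,(m)_2$ denote the components of $m\in M$, and $M\Box\Lambda=(M_0\otimes\Lambda_0)\oplus(M_2\otimes\Lambda_2)$ with product $(m\otimes\lambda)(n\otimes\mu)=(mn)_0\otimes(\lambda\mu)_0+(mn)_2\otimes(\lambda\mu)_2$. $\mathcal{T}$ is the class of all such algebras $M=M_0\oplus M_2$ with $M_0^2\subset M_0$, $M_0M_2\subset M_2$, $M_2M_0\subset M_2$ for which $M\Box\Lambda$ is a Lie algebra. A Malcev algebra is an anticommutative algebra satisfying $((xy)z)x+((yz)x)x+((zx)x)y=(xz)(yx)$. *)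

theory Defs
  imports Complex_Main "HOL-Library.Function_Algebras"
begin

section \<open>Algebras over a field, carried by a subspace\<close>

definition algebra_on ::
  "('k::field \<Rightarrow> 'v::ab_group_add \<Rightarrow> 'v) \<Rightarrow> 'v set \<Rightarrow> ('v \<Rightarrow> 'v \<Rightarrow> 'v) \<Rightarrow> bool" where
  "algebra_on s S f \<longleftrightarrow>
     vector_space s \<and> module.subspace s S \<and>
     (\<forall>x\<in>S. \<forall>y\<in>S. f x y \<in> S) \<and>
     (\<forall>x\<in>S. \<forall>y\<in>S. \<forall>z\<in>S. f (x + y) z = f x z + f y z \<and> f z (x + y) = f z x + f z y) \<and>
     (\<forall>c. \<forall>x\<in>S. \<forall>y\<in>S. f (s c x) y = s c (f x y) \<and> f x (s c y) = s c (f x y))"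

definition lie_algebra_on ::
  "('k::field \<Rightarrow> 'v::ab_group_add \<Rightarrow> 'v) \<Rightarrow> 'v set \<Rightarrow> ('v \<Rightarrow> 'v \<Rightarrow> 'v) \<Rightarrow> bool" where
  "lie_algebra_on s S f \<longleftrightarrow>
     algebra_on s S f \<and>
     (\<forall>x\<in>S. f x x = 0) \<and>
     (\<forall>x\<in>S. \<forall>y\<in>S. \<forall>z\<in>S. f (f x y) z + f (f y z) x + f (f z x) y = 0)"

definition malcev_algebra_on ::
  "('k::field \<Rightarrow> 'v::ab_group_add \<Rightarrow> 'v) \<Rightarrow> 'v set \<Rightarrow> ('v \<Rightarrow> 'v \<Rightarrow> 'v) \<Rightarrow> bool" where
  "malcev_algebra_on s S f \<longleftrightarrow>
     algebra_on s S f \<and>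
     (\<forall>x\<in>S. \<forall>y\<in>S. f x y = - f y x) \<and>
     (\<forall>x\<in>S. \<forall>y\<in>S. \<forall>z\<in>S.
        f (f (f x y) z) x + f (f (f y z) x) x + f (f (f z x) x) y = f (f x z) (f y x))"


section \<open>Decompositions into two subspaces\<close>

definition decomposition ::
  "('k::field \<Rightarrow> 'v::ab_group_add \<Rightarrow> 'v) \<Rightarrow> 'v set \<Rightarrow> 'v set \<Rightarrow> bool" where
  "decomposition s U W \<longleftrightarrow>
     module.subspace s U \<and> module.subspace s W \<and>
     U \<inter> W = {0} \<and> (\<forall>m. \<exists>u\<in>U. \<exists>w\<in>W. m = u + w)"

text \<open>The component in \<open>U\<close> of a vector, along \<open>W\<close>; meaningful when \<open>U\<close> and \<open>W\<close> form a
  decomposition. The other component is \<open>component W U\<close>.\<close>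

definition component :: "'v::ab_group_add set \<Rightarrow> 'v set \<Rightarrow> 'v \<Rightarrow> 'v" where
  "component U W m = (THE u. u \<in> U \<and> (\<exists>w\<in>W. m = u + w))"

lemma component_eqI:
  assumes V: "vector_space s" and D: "decomposition s U W"
    and "u \<in> U" "w \<in> W" "m = u + w"
  shows "component U W m = u"
  unfolding component_def
proof (rule the_equality)
  interpret vector_space s by (rule V)
  show "u \<in> U \<and> (\<exists>w\<in>W. m = u + w)" using assms by auto
  fix u' assume "u' \<in> U \<and> (\<exists>w\<in>W. m = u' + w)"
  then obtain w' where w': "u' \<in> U" "w' \<in> W" "m = u' + w'" by auto
  have "u' - u = w - w'" using w' assms(5) by (simp add: algebra_simps)
  moreover have "u' - u \<in> U" "w - w' \<in> W"
    using D w' assms(3,4) by (auto simp: decomposition_def intro: subspace_diff)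
  ultimately have "u' - u \<in> U \<inter> W" by (metis IntI)
  moreover have "U \<inter> W = {0}" using D by (simp add: decomposition_def)
  ultimately have "u' - u = 0" by blast
  then show "u' = u" by simp
qed

lemma decomposition_commute: "decomposition s U W \<Longrightarrow> decomposition s W U"
  by (auto simp: decomposition_def Int_commute) (metis add.commute)

lemma component_in:
  assumes "vector_space s" "decomposition s U W"
  shows "component U W m \<in> U"
proof -
  obtain u w where uw: "u \<in> U" "w \<in> W" "m = u + w"
    using assms(2) unfolding decomposition_def by blast
  show ?thesis using component_eqI[OF assms uw] uw(1) by simp
qed

lemma component_sum:
  assumes "vector_space s" "decomposition s U W"
  shows "component U W m + component W U m = m"
proof -
  obtain u w where uw: "u \<in> U" "w \<in> W" "m = u + w"
    using assms(2) unfolding decomposition_def by blast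
  have "component W U m = w"
    by (rule component_eqI[OF assms(1) decomposition_commute[OF assms(2)] uw(2) uw(1)])
      (simp add: uw(3) add.commute)
  then show ?thesis using component_eqI[OF assms uw] uw(3) by simp
qed

lemma component_linear:
  assumes V: "vector_space s" and D: "decomposition s U W"
  shows "Vector_Spaces.linear s s (component U W)"
proof -
  interpret vector_space s by (rule V)
  have sub: "subspace U" "subspace W" using D by (auto simp: decomposition_def)
  have ex: "\<exists>u w. u \<in> U \<and> w \<in> W \<and> m = u + w" for m
    using D unfolding decomposition_def by blast
  have add: "component U W (x + y) = component U W x + component U W y" for x y
  proof -
    obtain u w where a: "u \<in> U" "w \<in> W" "x = u + w" using ex by blast
    obtain u' w' where b: "u' \<in> U" "w' \<in> W" "y = u' + w'" using ex by blast
    have "component U W (x + y) = u + u'"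
      by (rule component_eqI[OF V D, where w = "w + w'"])
        (use a b sub in \<open>auto intro: subspace_add simp: algebra_simps\<close>)
    then show ?thesis using component_eqI[OF V D a] component_eqI[OF V D b] by simp
  qed
  have sc: "component U W (s c x) = s c (component U W x)" for c x
  proof -
    obtain u w where a: "u \<in> U" "w \<in> W" "x = u + w" using ex by blast
    have "component U W (s c x) = s c u"
      by (rule component_eqI[OF V D, where w = "s c w"])
        (use a sub in \<open>auto intro: subspace_scale simp: scale_right_distrib\<close>)
    then show ?thesis using component_eqI[OF V D a] by simp
  qed
  show ?thesis by unfold_locales (auto simp: add sc)
qed


section \<open>The algebra \<open>\<Lambda>\<close>\<close>

text \<open>Elements of \<open>\<Lambda>\<close> are their coordinate families with respect to the basis \<open>a, v, w\<close>.
  Addition is the pointwise one of \<^theory>\<open>HOL-Library.Function_Algebras\<close>; the pointwise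
  product provided there is not the product of \<open>\<Lambda>\<close>.\<close>

datatype idx = Ia | Iv | Iw

type_synonym 'k lam = "idx \<Rightarrow> 'k"

lemma UNIV_idx: "UNIV = {Ia, Iv, Iw}"
  using idx.exhaust by auto

instance idx :: finite
  by standard (simp add: UNIV_idx)

lemma sum_idx: "(\<Sum>i\<in>UNIV. g i) = g Ia + g Iv + g Iw"
  for g :: "idx \<Rightarrow> 'a::comm_monoid_add"
  by (simp add: UNIV_idx add.assoc)

definition scale_fun :: "('k \<Rightarrow> 'v \<Rightarrow> 'v) \<Rightarrow> 'k \<Rightarrow> ('i \<Rightarrow> 'v) \<Rightarrow> ('i \<Rightarrow> 'v)" where
  "scale_fun s c f = (\<lambda>i. s c (f i))"

abbreviation lam_scale :: "'k::field \<Rightarrow> 'k lam \<Rightarrow> 'k lam" where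
  "lam_scale \<equiv> scale_fun (*)"

definition bas :: "idx \<Rightarrow> 'k::field lam" where
  "bas i = (\<lambda>j. if j = i then 1 else 0)"

abbreviation lam_a :: "'k::field lam" where "lam_a \<equiv> bas Ia"
abbreviation lam_v :: "'k::field lam" where "lam_v \<equiv> bas Iv"
abbreviation lam_w :: "'k::field lam" where "lam_w \<equiv> bas Iw"

fun bas_mult :: "idx \<Rightarrow> idx \<Rightarrow> 'k::field lam" where
  "bas_mult Ia Ia = lam_a"
| "bas_mult Ia Iv = lam_v"
| "bas_mult Iv Ia = lam_v"
| "bas_mult Ia Iw = lam_w"
| "bas_mult Iw Ia = lam_w"
| "bas_mult Iv Iv = lam_scale (1/3) (lam_v + lam_scale 2 lam_a)"
| "bas_mult Iw Iw = lam_scale (1/3) (lam_w + lam_scale 2 lam_a)"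
| "bas_mult Iv Iw = - lam_scale (1/3) (lam_v + lam_w + lam_a)"
| "bas_mult Iw Iv = - lam_scale (1/3) (lam_v + lam_w + lam_a)"

definition lam_mult :: "'k::field lam \<Rightarrow> 'k lam \<Rightarrow> 'k lam" where
  "lam_mult x y = (\<Sum>i\<in>UNIV. \<Sum>j\<in>UNIV. lam_scale (x i * y j) (bas_mult i j))"

definition Lam0 :: "'k::field lam set" where
  "Lam0 = module.span lam_scale {lam_a}"

definition Lam2 :: "'k::field lam set" where
  "Lam2 = module.span lam_scale {lam_v, lam_w}"

lemma vector_space_scale_fun:
  assumes "vector_space s"
  shows "vector_space (scale_fun s)"
proof -
  interpret vector_space s by (rule assms)
  show ?thesis
    by unfold_locales (auto simp: scale_fun_def fun_eq_iff scale_right_distrib scale_left_distrib)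
qed

lemma vector_space_lam: "vector_space (lam_scale :: 'k::field \<Rightarrow> _)"
  by (rule vector_space_scale_fun) (unfold_locales, auto simp: algebra_simps)

lemma sum_fun_apply: "(\<Sum>i\<in>A. f i) x = (\<Sum>i\<in>A. f i x)"
  for f :: "'i \<Rightarrow> 'j \<Rightarrow> 'v::comm_monoid_add"
  by (induction A rule: infinite_finite_induct) auto

lemma lam_mult_bas: "lam_mult (bas i) (bas j) = bas_mult i j"
  by (cases i; cases j) (simp_all add: lam_mult_def sum_idx bas_def scale_fun_def fun_eq_iff)

lemma bas_mult_commute: "bas_mult i j = bas_mult j i"
  by (cases i; cases j) simp_all

lemma lam_mult_commute: "lam_mult x y = lam_mult y x"
  unfolding lam_mult_def
  by (subst sum.swap) (simp add: bas_mult_commute mult.commute)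

lemma algebra_on_lam: "algebra_on lam_scale UNIV (lam_mult :: 'k::field lam \<Rightarrow> _)"
proof -
  interpret vector_space "lam_scale :: 'k \<Rightarrow> _" by (rule vector_space_lam)
  show ?thesis
    unfolding algebra_on_def lam_mult_def
    by (auto simp: vector_space_lam sum_idx scale_fun_def fun_eq_iff algebra_simps)
qed

lemma Lam0_iff: "x \<in> Lam0 \<longleftrightarrow> x Iv = 0 \<and> x Iw = 0"
proof -
  interpret vector_space "lam_scale :: 'k::field \<Rightarrow> _" by (rule vector_space_lam)
  show ?thesis
  proof
    assume "x \<in> Lam0"
    then show "x Iv = 0 \<and> x Iw = 0"
      unfolding Lam0_def by (auto simp: span_singleton scale_fun_def bas_def)
  next
    assume "x Iv = 0 \<and> x Iw = 0"
    then have "x = lam_scale (x Ia) lam_a"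
      by (auto simp: fun_eq_iff scale_fun_def bas_def) (metis idx.exhaust)
    then show "x \<in> Lam0" unfolding Lam0_def span_singleton by blast
  qed
qed

lemma Lam2_iff: "x \<in> Lam2 \<longleftrightarrow> x Ia = 0"
proof -
  interpret vector_space "lam_scale :: 'k::field \<Rightarrow> _" by (rule vector_space_lam)
  show ?thesis
  proof
    assume "x \<in> Lam2"
    then show "x Ia = 0" unfolding Lam2_def
      by (induction rule: span_induct_alt) (auto simp: scale_fun_def bas_def)
  next
    assume 0: "x Ia = 0"
    have "x = lam_scale (x Iv) lam_v + lam_scale (x Iw) lam_w"
    proof
      fix i show "x i = (lam_scale (x Iv) lam_v + lam_scale (x Iw) lam_w) i"
        using 0 by (cases i) (auto simp: scale_fun_def bas_def)
    qed
    also have "\<dots> \<in> Lam2" unfolding Lam2_def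
      by (intro span_add span_scale span_base) auto
    finally show "x \<in> Lam2" .
  qed
qed

lemma decomposition_lam: "decomposition lam_scale (Lam0 :: 'k::field lam set) Lam2"
proof -
  interpret vector_space "lam_scale :: 'k \<Rightarrow> _" by (rule vector_space_lam)
  have "Lam0 \<inter> Lam2 = {0 :: 'k lam}"
    by (auto simp: Lam0_iff Lam2_iff fun_eq_iff) (metis idx.exhaust)
  moreover have "\<exists>u\<in>Lam0. \<exists>w\<in>Lam2. m = u + w" for m :: "'k lam"
    by (rule bexI[where x = "\<lambda>i. if i = Ia then m i else 0"],
        rule bexI[where x = "\<lambda>i. if i = Ia then 0 else m i"])
      (auto simp: Lam0_iff Lam2_iff fun_eq_iff)
  ultimately show ?thesis
    unfolding decomposition_def by (auto simp: Lam0_def Lam2_def)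
qed


section \<open>The tensor product \<open>M \<otimes> \<Lambda>\<close>\<close>

text \<open>Since \<open>\<Lambda>\<close> has the basis \<open>a, v, w\<close>, the space \<open>M \<otimes> \<Lambda>\<close> is modelled by the
  \<open>M\<close>-valued coordinate families; the universal property is proved below.\<close>

definition tensor :: "('k \<Rightarrow> 'm \<Rightarrow> 'm) \<Rightarrow> 'm \<Rightarrow> 'k lam \<Rightarrow> (idx \<Rightarrow> 'm)" where
  "tensor s m x = (\<lambda>i. s (x i) m)"

lemma tensor_bilinear:
  assumes "vector_space s"
  shows "Vector_Spaces.linear s (scale_fun s) (\<lambda>m. tensor s m x)"
    and "Vector_Spaces.linear lam_scale (scale_fun s) (tensor s m)"
proof -
  interpret vector_space s by (rule assms)
  interpret F: vector_space "scale_fun s :: _ \<Rightarrow> (idx \<Rightarrow> _) \<Rightarrow> _"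
    by (rule vector_space_scale_fun[OF assms])
  interpret L: vector_space "lam_scale :: 'a \<Rightarrow> _" by (rule vector_space_lam)
  show "Vector_Spaces.linear s (scale_fun s) (\<lambda>m. tensor s m x)"
    by unfold_locales
      (auto simp: tensor_def scale_fun_def fun_eq_iff scale_right_distrib mult.commute)
  show "Vector_Spaces.linear lam_scale (scale_fun s) (tensor s m)"
    by unfold_locales
      (auto simp: tensor_def scale_fun_def fun_eq_iff scale_left_distrib)
qed

lemma tensor_expand:
  assumes "vector_space s"
  shows "t = (\<Sum>i\<in>UNIV. tensor s (t i) (bas i))"
proof
  interpret vector_space s by (rule assms)
  fix j show "t j = (\<Sum>i\<in>UNIV. tensor s (t i) (bas i)) j"
    by (cases j) (simp_all add: sum_idx tensor_def bas_def)
qed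

lemma lam_expand: "x = (\<Sum>i\<in>UNIV. lam_scale (x i) (bas i))"
proof
  fix j show "x j = (\<Sum>i\<in>UNIV. lam_scale (x i) (bas i)) j"
    by (cases j) (simp_all add: sum_idx scale_fun_def bas_def)
qed

theorem tensor_universal:
  fixes s :: "'k::field \<Rightarrow> 'm::ab_group_add \<Rightarrow> 'm" and s' :: "'k \<Rightarrow> 'n::ab_group_add \<Rightarrow> 'n"
  assumes "vector_space s" "vector_space s'"
    and B1: "\<And>x. Vector_Spaces.linear s s' (\<lambda>m. B m x)"
    and B2: "\<And>m. Vector_Spaces.linear lam_scale s' (B m)"
  shows "\<exists>!F. Vector_Spaces.linear (scale_fun s) s' F \<and> (\<forall>m x. F (tensor s m x) = B m x)"
proof -
  interpret vector_space s by (rule assms)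
  interpret N: vector_space s' by (rule assms)
  interpret T: vector_space "scale_fun s :: _ \<Rightarrow> (idx \<Rightarrow> _) \<Rightarrow> _"
    by (rule vector_space_scale_fun[OF assms(1)])
  interpret B1: Vector_Spaces.linear s s' "\<lambda>m. B m x" for x by (rule B1)
  interpret B2: Vector_Spaces.linear lam_scale s' "B m" for m by (rule B2)
  define F where "F t = (\<Sum>i\<in>UNIV. B (t i) (bas i))" for t
  have lin: "Vector_Spaces.linear (scale_fun s) s' F"
    by unfold_locales
      (auto simp: F_def scale_fun_def B1.add B1.scale sum.distrib N.scale_sum_right)
  have F: "F (tensor s m x) = B m x" for m x
  proof -
    have "F (tensor s m x) = (\<Sum>i\<in>UNIV. B m (lam_scale (x i) (bas i)))"
      by (simp add: F_def tensor_def B1.scale B2.scale)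
    also have "\<dots> = B m (\<Sum>i\<in>UNIV. lam_scale (x i) (bas i))" by (simp add: B2.sum)
    finally show ?thesis using lam_expand[of x] by simp
  qed
  show ?thesis
  proof (rule ex1I[of _ F])
    fix G assume G: "Vector_Spaces.linear (scale_fun s) s' G \<and> (\<forall>m x. G (tensor s m x) = B m x)"
    then interpret G: Vector_Spaces.linear "scale_fun s" s' G by simp
    show "G = F"
    proof
      fix t
      have "G t = G (\<Sum>i\<in>UNIV. tensor s (t i) (bas i))"
        using tensor_expand[OF assms(1), of t] by simp
      also have "\<dots> = F t" using G by (simp only: G.sum F_def)
      finally show "G t = F t" .
    qed
  qed (use lin F in blast)
qed


section \<open>The algebra \<open>M \<box> \<Lambda>\<close>\<close>

definition box_carrier ::
  "('k::field \<Rightarrow> 'm::ab_group_add \<Rightarrow> 'm) \<Rightarrow> 'm set \<Rightarrow> 'm set \<Rightarrow> (idx \<Rightarrow> 'm) set" where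
  "box_carrier s M0 M2 =
     {p + q | p q.
        p \<in> module.span (scale_fun s) {tensor s m x | m x. m \<in> M0 \<and> x \<in> Lam0} \<and>
        q \<in> module.span (scale_fun s) {tensor s m x | m x. m \<in> M2 \<and> x \<in> Lam2}}"

definition box_pure ::
  "('k::field \<Rightarrow> 'm::ab_group_add \<Rightarrow> 'm) \<Rightarrow> ('m \<Rightarrow> 'm \<Rightarrow> 'm) \<Rightarrow> 'm set \<Rightarrow> 'm set \<Rightarrow>
     'm \<Rightarrow> 'k lam \<Rightarrow> 'm \<Rightarrow> 'k lam \<Rightarrow> (idx \<Rightarrow> 'm)" where
  "box_pure s f M0 M2 m x n y =
     tensor s (component M0 M2 (f m n)) (component Lam0 Lam2 (lam_mult x y)) +
     tensor s (component M2 M0 (f m n)) (component Lam2 Lam0 (lam_mult x y))"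

text \<open>The bilinear extension of the product of pure tensors, using that \<open>t\<close> is the sum
  of the tensors \<open>t i \<otimes> bas i\<close>.\<close>

definition box_mult ::
  "('k::field \<Rightarrow> 'm::ab_group_add \<Rightarrow> 'm) \<Rightarrow> ('m \<Rightarrow> 'm \<Rightarrow> 'm) \<Rightarrow> 'm set \<Rightarrow> 'm set \<Rightarrow>
     (idx \<Rightarrow> 'm) \<Rightarrow> (idx \<Rightarrow> 'm) \<Rightarrow> (idx \<Rightarrow> 'm)" where
  "box_mult s f M0 M2 t u =
     (\<Sum>i\<in>UNIV. \<Sum>j\<in>UNIV. box_pure s f M0 M2 (t i) (bas i) (u j) (bas j))"

lemma box_mult_tensor:
  fixes s :: "'k::field \<Rightarrow> 'm::ab_group_add \<Rightarrow> 'm"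
  assumes A: "algebra_on s UNIV f" and D: "decomposition s M0 M2"
  shows "box_mult s f M0 M2 (tensor s m x) (tensor s n y) = box_pure s f M0 M2 m x n y"
proof -
  have V: "vector_space s" using A by (simp add: algebra_on_def)
  interpret vector_space s by (rule V)
  interpret T: vector_space "scale_fun s :: _ \<Rightarrow> (idx \<Rightarrow> _) \<Rightarrow> _"
    by (rule vector_space_scale_fun[OF V])
  interpret L: vector_space "lam_scale :: 'k \<Rightarrow> _" by (rule vector_space_lam)
  interpret c0: Vector_Spaces.linear s s "component M0 M2" by (rule component_linear[OF V D])
  interpret c2: Vector_Spaces.linear s s "component M2 M0"
    by (rule component_linear[OF V decomposition_commute[OF D]])
  interpret l0: Vector_Spaces.linear lam_scale lam_scale "component (Lam0 :: 'k lam set) Lam2"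
    by (rule component_linear[OF vector_space_lam decomposition_lam])
  interpret l2: Vector_Spaces.linear lam_scale lam_scale "component (Lam2 :: 'k lam set) Lam0"
    by (rule component_linear[OF vector_space_lam decomposition_commute[OF decomposition_lam]])
  interpret t1: Vector_Spaces.linear s "scale_fun s" "\<lambda>p. tensor s p z" for z
    by (rule tensor_bilinear[OF V])
  interpret t2: Vector_Spaces.linear lam_scale "scale_fun s" "tensor s p" for p
    by (rule tensor_bilinear[OF V])
  have fs: "f (s c p) q = s c (f p q)" "f p (s c q) = s c (f p q)" for c p q
    using A by (auto simp: algebra_on_def)
  have P: "box_pure s f M0 M2 (s c m) (bas i) (s d n) (bas j) =
      tensor s (component M0 M2 (f m n)) (component Lam0 Lam2 (lam_scale (c * d) (bas_mult i j))) +
      tensor s (component M2 M0 (f m n)) (component Lam2 Lam0 (lam_scale (c * d) (bas_mult i j)))"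
    for c d i j
    by (simp add: box_pure_def fs c0.scale c2.scale t1.scale l0.scale l2.scale t2.scale
        lam_mult_bas mult.commute)
  have "box_mult s f M0 M2 (tensor s m x) (tensor s n y) =
      (\<Sum>i\<in>UNIV. \<Sum>j\<in>UNIV. box_pure s f M0 M2 (s (x i) m) (bas i) (s (y j) n) (bas j))"
    by (simp add: box_mult_def tensor_def[of s m x] tensor_def[of s n y])
  also have "\<dots> = box_pure s f M0 M2 m x n y"
    unfolding P unfolding box_pure_def lam_mult_def
    by (simp only: l0.sum l2.sum t2.sum sum.distrib)
  finally show ?thesis .
qed

lemma box_carrier_iff:
  assumes V: "vector_space s" and M0: "module.subspace s M0" and M2: "module.subspace s M2"
  shows "t \<in> box_carrier s M0 M2 \<longleftrightarrow> t Ia \<in> M0 \<and> t Iv \<in> M2 \<and> t Iw \<in> M2"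
proof -
  interpret vector_space s by (rule V)
  interpret T: vector_space "scale_fun s :: _ \<Rightarrow> (idx \<Rightarrow> _) \<Rightarrow> _"
    by (rule vector_space_scale_fun[OF V])
  let ?A = "{tensor s m x | m x. m \<in> M0 \<and> x \<in> Lam0}"
  let ?B = "{tensor s m x | m x. m \<in> M2 \<and> x \<in> Lam2}"
  note z = subspace_0[OF M0] subspace_0[OF M2]
  show ?thesis
  proof
    assume "t \<in> box_carrier s M0 M2"
    then obtain p q where pq: "t = p + q" "p \<in> T.span ?A" "q \<in> T.span ?B"
      unfolding box_carrier_def by blast
    have "p Ia \<in> M0 \<and> p Iv = 0 \<and> p Iw = 0" using pq(2)
      by (induction rule: T.span_induct_alt)
        (auto simp: z scale_fun_def tensor_def Lam0_iff intro!: subspace_add[OF M0] subspace_scale[OF M0])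
    moreover have "q Ia = 0 \<and> q Iv \<in> M2 \<and> q Iw \<in> M2" using pq(3)
      by (induction rule: T.span_induct_alt)
        (auto simp: z scale_fun_def tensor_def Lam2_iff intro!: subspace_add[OF M2] subspace_scale[OF M2])
    ultimately show "t Ia \<in> M0 \<and> t Iv \<in> M2 \<and> t Iw \<in> M2" by (simp add: pq(1))
  next
    assume t: "t Ia \<in> M0 \<and> t Iv \<in> M2 \<and> t Iw \<in> M2"
    have l: "lam_a \<in> Lam0" "lam_v \<in> Lam2" "lam_w \<in> Lam2"
      by (auto simp: Lam0_iff Lam2_iff bas_def)
    have "t = tensor s (t Ia) lam_a + (tensor s (t Iv) lam_v + tensor s (t Iw) lam_w)"
      using tensor_expand[OF V, of t] by (simp add: sum_idx add.assoc)
    moreover have "tensor s (t Ia) lam_a \<in> T.span ?A"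
      using t l by (intro T.span_base) blast
    moreover have "tensor s (t Iv) lam_v + tensor s (t Iw) lam_w \<in> T.span ?B"
      using t l by (intro T.span_add T.span_base) blast+
    ultimately show "t \<in> box_carrier s M0 M2" unfolding box_carrier_def by blast
  qed
qed


section \<open>The class \<open>\<T>\<close>\<close>

definition class_T ::
  "('k::field \<Rightarrow> 'm::ab_group_add \<Rightarrow> 'm) \<Rightarrow> ('m \<Rightarrow> 'm \<Rightarrow> 'm) \<Rightarrow> 'm set \<Rightarrow> 'm set \<Rightarrow> bool" where
  "class_T s f M0 M2 \<longleftrightarrow>
     algebra_on s UNIV f \<and> decomposition s M0 M2 \<and>
     (\<forall>x\<in>M0. \<forall>y\<in>M0. f x y \<in> M0) \<and>
     (\<forall>x\<in>M0. \<forall>y\<in>M2. f x y \<in> M2) \<and>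
     (\<forall>x\<in>M2. \<forall>y\<in>M0. f x y \<in> M2) \<and>
     lie_algebra_on (scale_fun s) (box_carrier s M0 M2) (box_mult s f M0 M2)"

end

theory Submission
  imports Defs
begin

text \<open>
  Write \<open>x \<star> y = (xy)\<^sub>2\<close> and \<open>D(x,y) = (xy)\<^sub>0\<close> for \<open>x, y \<in> M\<^sub>2\<close>. The Lie identities of
  \<open>M \<box> \<Lambda>\<close> on \<open>m \<otimes> a, x \<otimes> v, y \<otimes> v\<close> say that \<open>M\<^sub>0\<close> acts on \<open>(M\<^sub>2, \<star>)\<close> by derivations, and
  the \<open>v\<close>-coordinate on \<open>x \<otimes> v, y \<otimes> v, z \<otimes> w\<close> is
  \<open>(x \<star> y) \<star> z = - 3 (D(y,z) x + D(z,x) y)\<close>. Combining its cyclic shifts,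
  \<open>6 D(x,y) z = (x \<star> y) \<star> z - (y \<star> z) \<star> x - (z \<star> x) \<star> y = 2 (x \<star> y) \<star> z - J(x,y,z)\<close>
  is a derivation in \<open>z\<close>, where \<open>J\<close> is the Jacobian of \<open>\<star>\<close>. Applying it to \<open>x \<star> z\<close> gives
  \<open>J(x,y,x \<star> z) + 2 J(x,z,x \<star> y) = - J(x,y,z) \<star> x\<close>; together with the same identity for
  \<open>y\<close> and \<open>z\<close> exchanged this yields \<open>3 J(x,y,x \<star> z) = 3 J(x,y,z) \<star> x\<close>, which is the
  Malcev identity.
\<close>

section \<open>Anticommutative products with derivations \<open>P x y\<close>\<close>

text \<open>Isolates the part of the argument that concerns the single product \<open>p\<close>; the
  field survives only as the absence of 3-torsion. Since \<open>P x y z\<close> is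
  \<open>2 (xy)z - J x y z\<close>, its derivation rule relates Jacobians to one another.\<close>

lemma malcev_identity_of_derivations:
  fixes p :: "'m::ab_group_add \<Rightarrow> 'm \<Rightarrow> 'm"
  defines "P \<equiv> \<lambda>x y z. p (p x y) z - p (p y z) x - p (p z x) y"
  assumes addl: "\<And>x y z. p (x + y) z = p x z + p y z"
    and addr: "\<And>x y z. p z (x + y) = p z x + p z y"
    and alt: "\<And>x. p x x = 0"
    and deriv: "\<And>x y u v. P x y (p u v) = p (P x y u) v + p u (P x y v)"
    and torsion: "\<And>x::'m. x + x + x = 0 \<Longrightarrow> x = 0"
  shows "p (p (p x y) z) x + p (p (p y z) x) x + p (p (p z x) x) y = p (p x z) (p y x)"
proof -
  have anti: "p u v = - p v u" for u v
    using alt[of "u + v"] unfolding addl addr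
    by (simp add: alt eq_neg_iff_add_eq_0 add.commute)
  have negl: "p (- u) v = - p u v" for u v
    using addl[of "-u" u v] addl[of 0 0 v] by (simp add: eq_neg_iff_add_eq_0)
  have negr: "p u (- v) = - p u v" for u v
    using addr[of u "-v" v] addr[of u 0 0] by (simp add: eq_neg_iff_add_eq_0)
  have subl: "p (u - v) w = p u w - p v w" for u v w
    using addl[of u "-v" w] by (simp add: negl)
  have subr: "p w (u - v) = p w u - p w v" for u v w
    using addr[of w u "-v"] by (simp add: negr)
  define J where "J u v w = p (p u v) w + p (p v w) u + p (p w u) v" for u v w
  have zerol: "p 0 v = 0" for v using addl[of 0 0 v] by simp
  note lin = zerol addl addr negl negr subl subr
  have J_eq: "J u v w = p (p u v) w + p (p v w) u - p (p u w) v" for u v w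
    unfolding J_def by (simp add: anti[of w u] lin)
  have J_swap: "J u v w = - J u w v" for u v w
    unfolding J_eq by (simp add: anti[of w v] lin)
  have J1: "J x y (p x z) = p (p x y) (p x z) - p (p (p x z) y) x + p (p (p x z) x) y" for y z
    by (simp add: J_eq anti[of y "p x z"] anti[of x "p x z"] lin)
  have J2: "p (J x y z) x = p (p (p x y) z) x + p (p (p y z) x) x - p (p (p x z) y) x" for y z
    by (simp add: J_eq lin)
  have step: "J x y (p x z) + J x z (p x y) + J x z (p x y) = - p (J x y z) x" for y z
  proof -
    define A B C where "A = p x y" and "B = p x z" and "C = p y z"
    note abc = A_def[symmetric] B_def[symmetric] C_def[symmetric]
    have "P x y B = p A B + p (p B y) x - p (p B x) y"
      by (simp add: P_def A_def anti[of y B] lin)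
    moreover have "P x y x = p A x + p A x"
      by (simp add: P_def A_def anti[of y x] alt lin)
    moreover have "P x y z = p A z - p C x + p B y"
      by (simp add: P_def A_def B_def C_def anti[of z x] lin)
    ultimately have "p A B + p (p B y) x - p (p B x) y
        = p (p A x) z + p (p A x) z - (p (p A z) x - p (p C x) x + p (p B y) x)"
      using deriv[of x y x z] anti[of x "P x y z"] by (simp add: abc lin)
    \<comment> \<open>The derivation rule on \<open>p x z\<close> is solved for
      \<open>p A B\<close>, its only product of two products; every other term is a left-normed
      word, so substituting it into \<open>J1\<close> leaves a linear comparison.\<close>
    then have AB: "p A B = p (p B x) y - p (p B y) x
        + p (p A x) z + p (p A x) z - (p (p A z) x - p (p C x) x + p (p B y) x)"
      by (simp add: algebra_simps)
    have BA: "p B A = - p A B" by (rule anti)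
    show ?thesis unfolding J1 J2 unfolding abc BA unfolding AB by (simp add: algebra_simps)
  qed
  \<comment> \<open>\<open>d\<close> is the defect of the Malcev identity in Jacobian form.
    Exchanging \<open>y\<close> and \<open>z\<close> in \<open>step\<close> eliminates
    \<open>J x z (p x y)\<close> and leaves \<open>3 d = 0\<close>.\<close>
  define d where "d = J x y (p x z) - p (J x y z) x"
  have "p (J x z y) x = - p (J x y z) x" by (subst J_swap) (simp add: negl)
  then have W: "J x z (p x y) = p (J x y z) x - J x y (p x z) - J x y (p x z)"
    using step[of z y] by (simp add: algebra_simps)
  have "d + d + d = - (J x y (p x z) + J x z (p x y) + J x z (p x y)) - p (J x y z) x"
    unfolding d_def W by (simp add: algebra_simps)
  then have "d + d + d = 0" unfolding step by simp
  then have "d = 0" by (rule torsion)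
  then have "p (p x y) (p x z) - p (p (p x z) y) x + p (p (p x z) x) y
      = p (p (p x y) z) x + p (p (p y z) x) x - p (p (p x z) y) x"
    unfolding d_def J1 J2 by simp
  then have main: "p (p x y) (p x z) + p (p (p x z) x) y = p (p (p x y) z) x + p (p (p y z) x) x"
    by (simp add: algebra_simps)
  have "p (p (p z x) x) y = - p (p (p x z) x) y" by (simp add: anti[of z x] lin)
  moreover have "p (p x z) (p y x) = p (p x y) (p x z)"
    by (simp add: anti[of y x] anti[of "p x z" "p x y"] lin)
  ultimately show ?thesis
    unfolding main[symmetric] by simp
qed

section \<open>Coordinates of products in \<open>M \<box> \<Lambda>\<close>\<close>

lemma component_Lam0: "component Lam0 Lam2 (x :: 'k::field lam) = (\<lambda>i. if i = Ia then x i else 0)"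
  by (rule component_eqI[OF vector_space_lam decomposition_lam,
        where w = "\<lambda>i. if i = Ia then 0 else x i"])
    (auto simp: Lam0_iff Lam2_iff fun_eq_iff)

lemma component_Lam2: "component Lam2 Lam0 (x :: 'k::field lam) = (\<lambda>i. if i = Ia then 0 else x i)"
  by (rule component_eqI[OF vector_space_lam decomposition_commute[OF decomposition_lam],
        where w = "\<lambda>i. if i = Ia then x i else 0"])
    (auto simp: Lam0_iff Lam2_iff fun_eq_iff)

text \<open>The scalars come from the table of \<Lambda>: \<open>2/3\<close> is the coefficient of
  \<open>a\<close> in the squares of \<open>v\<close> and \<open>w\<close>, and \<open>-1/3\<close>
  is every coefficient of \<open>vw\<close>.\<close>

lemma box_mult_coordinates:
  fixes s :: "'k::field \<Rightarrow> 'm::ab_group_add \<Rightarrow> 'm" and f :: "'m \<Rightarrow> 'm \<Rightarrow> 'm"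
    and t u :: "idx \<Rightarrow> 'm" and M0 M2 :: "'m set"
  defines "p \<equiv> \<lambda>i j. component M2 M0 (f (t i) (u j))"
    and "b \<equiv> \<lambda>i j. component M0 M2 (f (t i) (u j))"
  assumes V: "vector_space s"
  shows "box_mult s f M0 M2 t u Ia =
      b Ia Ia + s (2/3) (b Iv Iv + b Iw Iw) - s (1/3) (b Iv Iw + b Iw Iv)"
    and "box_mult s f M0 M2 t u Iv =
      p Ia Iv + p Iv Ia + s (1/3) (p Iv Iv - p Iv Iw - p Iw Iv)"
    and "box_mult s f M0 M2 t u Iw =
      p Ia Iw + p Iw Ia + s (1/3) (p Iw Iw - p Iv Iw - p Iw Iv)"
proof -
  interpret vector_space s by (rule V)
  note defs = box_mult_def box_pure_def sum_idx lam_mult_bas component_Lam0 component_Lam2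
    tensor_def scale_fun_def p_def b_def
  show "box_mult s f M0 M2 t u Ia =
      b Ia Ia + s (2/3) (b Iv Iv + b Iw Iw) - s (1/3) (b Iv Iw + b Iw Iv)"
    by (simp add: defs) (simp add: bas_def algebra_simps)
  show "box_mult s f M0 M2 t u Iv =
      p Ia Iv + p Iv Ia + s (1/3) (p Iv Iv - p Iv Iw - p Iw Iv)"
    by (simp add: defs) (simp add: bas_def algebra_simps)
  show "box_mult s f M0 M2 t u Iw =
      p Ia Iw + p Iw Ia + s (1/3) (p Iw Iw - p Iv Iw - p Iw Iv)"
    by (simp add: defs) (simp add: bas_def algebra_simps)
qed

section \<open>From the Lie identities to the Malcev identity\<close>

theorem lemma2:
  fixes scale :: "'k::field \<Rightarrow> 'm::ab_group_add \<Rightarrow> 'm"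
    and mult :: "'m \<Rightarrow> 'm \<Rightarrow> 'm"
    and M0 M2 :: "'m set"
  assumes "CHAR('k) \<noteq> 2" and "CHAR('k) \<noteq> 3"
    and "class_T scale mult M0 M2"
  shows "malcev_algebra_on scale M2 (\<lambda>x y. component M2 M0 (mult x y))"
proof -
  have three: "(3::'k) \<noteq> 0"
  proof
    assume "(3::'k) = 0"
    then have "CHAR('k) dvd 3" using of_nat_eq_0_iff_char_dvd[of 3, where 'a = 'k] by simp
    \<comment> \<open>A characteristic dividing 3 is neither 0 nor 1, so excluding 3 leaves only 2,
      which does not divide 3.\<close>
    moreover from this have "CHAR('k) \<noteq> 0" "CHAR('k) \<le> 3"
      using dvd_imp_le[of "CHAR('k)" 3] by (auto intro: gr0I)
    then have "CHAR('k) = 2"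
      using assms(2) CHAR_not_1'[where 'a = 'k] by linarith
    ultimately show False by simp
  qed
  have A: "algebra_on scale UNIV mult" and D: "decomposition scale M0 M2"
    and M02: "\<And>x y. x \<in> M0 \<Longrightarrow> y \<in> M2 \<Longrightarrow> mult x y \<in> M2"
    and M20: "\<And>x y. x \<in> M2 \<Longrightarrow> y \<in> M0 \<Longrightarrow> mult x y \<in> M2"
    and lie: "lie_algebra_on (scale_fun scale) (box_carrier scale M0 M2) (box_mult scale mult M0 M2)"
    using assms(3) by (simp_all add: class_T_def)
  have V: "vector_space scale" using A by (simp add: algebra_on_def)
  interpret vector_space scale by (rule V)
  note D' = decomposition_commute[OF D]
  define c0 c2 where "c0 = component M0 M2" and "c2 = component M2 M0"
  interpret c0: Vector_Spaces.linear scale scale c0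
    unfolding c0_def by (rule component_linear[OF V D])
  interpret c2: Vector_Spaces.linear scale scale c2
    unfolding c2_def by (rule component_linear[OF V D'])
  have sub: "subspace M0" "subspace M2" using D by (auto simp: decomposition_def)
  have c0_in: "c0 x \<in> M0" and c2_in: "c2 x \<in> M2" for x
    unfolding c0_def c2_def by (rule component_in[OF V D] component_in[OF V D'])+
  have c2_id: "c2 x = x" if "x \<in> M2" for x
    unfolding c2_def
    by (rule component_eqI[OF V D' that subspace_0[OF sub(1)]]) simp
  have c2_c2: "c2 (c2 x) = c2 x" for x using c2_id c2_in by simp
  have mult_addl: "mult (x + y) z = mult x z + mult y z"
    and mult_addr: "mult z (x + y) = mult z x + mult z y"
    and mult_scl: "mult (scale c x) y = scale c (mult x y)"
    and mult_scr: "mult x (scale c y) = scale c (mult x y)" for x y z c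
    using A by (simp_all add: algebra_on_def)
  have mult_0: "mult 0 x = 0" "mult x 0 = 0" for x
    using mult_scl[of 0 0 x] mult_scr[of x 0 0] by simp_all
  have mult_neg: "mult (- x) y = - mult x y" "mult x (- y) = - mult x y" for x y
    using mult_scl[of "-1" x y] mult_scr[of x "-1" y] by simp_all
  have mult_diff: "mult (x - y) z = mult x z - mult y z" for x y z
    using mult_addl[of x "- y" z] by (simp add: mult_neg)
  note mult_simps = mult_addl mult_addr mult_scl mult_scr mult_0 mult_neg

  \<comment> \<open>Precomposing with the projections makes these maps bilinear on all of \<open>M\<close>, so that
    the identities below need no membership side conditions.\<close>
  define p where "p x y = c2 (mult (c2 x) (c2 y))" for x y
  define b where "b x y = c0 (mult (c2 x) (c2 y))" for x y
  define act where "act m x = mult (c0 m) (c2 x)" for m x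
  have c2_p: "c2 (p x y) = p x y" for x y by (simp add: p_def c2_c2)

  \<comment> \<open>The general element
    \<open>m \<otimes> a + x \<otimes> v + y \<otimes> w\<close>, projected so that it always lies
    in the carrier.\<close>
  define T where "T m x y = (\<lambda>i. case i of Ia \<Rightarrow> c0 m | Iv \<Rightarrow> c2 x | Iw \<Rightarrow> c2 y)" for m x y
  have T_in: "T m x y \<in> box_carrier scale M0 M2" for m x y
    by (simp add: box_carrier_iff[OF V sub] T_def c0_in c2_in)
  let ?B = "box_mult scale mult M0 M2"
  have sq: "?B (T m x y) (T m x y) = 0" for m x y
    using lie T_in by (simp add: lie_algebra_on_def)
  have jac: "?B (?B (T m x y) (T m' x' y')) (T m'' x'' y'')
      + ?B (?B (T m' x' y') (T m'' x'' y'')) (T m x y)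
      + ?B (?B (T m'' x'' y'') (T m x y)) (T m' x' y') = 0" for m x y m' x' y' m'' x'' y''
    using lie T_in by (simp add: lie_algebra_on_def)
  note coord = box_mult_coordinates[OF V, where ?M0.0 = M0 and ?M2.0 = M2, folded c0_def c2_def]
  have act2: "c2 (mult (c0 m) (c2 x)) = act m x" "c2 (mult (c2 x) (c0 m)) = mult (c2 x) (c0 m)"
    for m x
    unfolding act_def by (rule c2_id, intro M02 M20 c0_in c2_in)+

  have alt: "p x x = 0" for x
    using fun_cong[OF sq[of 0 x 0], of Iv] three
    by (simp add: coord T_def mult_0 p_def)
  have mult_anti: "mult (c2 x) (c0 m) = - act m x" for m x
    using fun_cong[OF sq[of m x 0], of Iv] alt[of x]
    by (simp add: coord T_def mult_0 act2 p_def eq_neg_iff_add_eq_0 add.commute)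

  have c0_c0: "c0 (c0 x) = c0 x" for x
    unfolding c0_def by (rule component_eqI[OF V D component_in[OF V D] subspace_0[OF sub(2)]]) simp
  have c0_b: "c0 (b x y) = b x y" for x y by (simp add: b_def c0_c0)
  have c2_act: "c2 (act m x) = act m x" for m x
    unfolding act_def by (intro c2_id M02 c0_in c2_in)
  \<comment> \<open>A product of two \<open>T\<close>s is again a \<open>T\<close>, so the nested
    products in \<open>jac\<close> unfold by rewriting.\<close>
  have box_T: "?B (T m x y) (T m' x' y') =
      T (mult (c0 m) (c0 m') + scale (2/3) (b x x' + b y y') - scale (1/3) (b x y' + b y x'))
        (act m x' - act m' x + scale (1/3) (p x x' - p x y' - p y x'))
        (act m y' - act m' y + scale (1/3) (p y y' - p x y' - p y x'))" for m x y m' x' y'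
  proof
    fix i
    show "?B (T m x y) (T m' x' y') i =
      T (mult (c0 m) (c0 m') + scale (2/3) (b x x' + b y y') - scale (1/3) (b x y' + b y x'))
        (act m x' - act m' x + scale (1/3) (p x x' - p x y' - p y x'))
        (act m y' - act m' y + scale (1/3) (p y y' - p x y' - p y x')) i"
      by (cases i)
        (simp_all add: coord T_def act2 mult_anti c0_b c2_act c2_p p_def[symmetric] b_def[symmetric]
          c0.add c0.scale c0.diff c2.add c2.scale c2.diff c2.neg)
  qed

  have p_addl: "p (x + y) z = p x z + p y z" and p_addr: "p z (x + y) = p z x + p z y"
    and p_scl: "p (scale c x) z = scale c (p x z)" and p_scr: "p z (scale c x) = scale c (p z x)"
    and p_negl: "p (- x) z = - p x z" and p_negr: "p z (- x) = - p z x"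
    and p_0: "p 0 z = 0" "p z 0 = 0" for x y z c
    by (simp_all add: p_def mult_simps c2.add c2.scale c2.neg)
  have b_0: "b 0 z = 0" "b z 0 = 0" for z
    by (simp_all add: b_def mult_0)
  have act_0: "act 0 z = 0" "act m 0 = 0" for z m by (simp_all add: act_def mult_0)
  have act_add: "act m (x + y) = act m x + act m y"
    and act_sc: "act m (scale c x) = scale c (act m x)"
    and act_neg: "act m (- x) = - act m x"
    and act_scl: "act (scale c m) x = scale c (act m x)"
    and act_negl: "act (- m) x = - act m x" for m x y c
    by (simp_all add: act_def mult_simps c2.add c2.scale c2.neg c0.scale c0.neg)
  have anti: "p x y = - p y x" for x y
    using alt[of "x + y"] unfolding p_addl p_addr
    by (simp add: alt eq_neg_iff_add_eq_0 add.commute)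
  have act_addl: "act (l + m) x = act l x + act m x"
    and act_diffl: "act (l - m) x = act l x - act m x" for l m x
    by (simp_all add: act_def mult_diff c0.diff c0.add mult_addl)
  note lin = act_addl act_diffl p_addl p_addr p_scl p_scr p_negl p_negr p_0 b_0 act_0 act_add act_sc
    act_neg act_scl act_negl

  have act_deriv: "act m (p x y) = p (act m x) y + p x (act m y)" for m x y
  proof -
    have "scale (1/3) (p (act m x) y - act m (p x y) - p (act m y) x) = 0"
      using fun_cong[OF jac[of m 0 0 0 x 0 0 y 0], of Iv]
      unfolding box_T
      by (simp add: lin mult_0 T_def c2.add c2.scale c2.diff c2.neg c2_act c2_p algebra_simps)
    then have "p (act m x) y - act m (p x y) - p (act m y) x = 0"
      using three by simp
    then show ?thesis using anti[of "act m y" x] by (simp add: algebra_simps)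
  qed
  have pp: "p (p x y) z = - scale 3 (act (b y z) x + act (b z x) y)" for x y z
  proof -
    \<comment> \<open>In the \<open>v\<close>-coordinate \<open>D(x,y) z\<close> is absent, as it
      sits at \<open>w\<close>, and the \<star>-terms of the other two cyclic summands
      cancel.\<close>
    have "(?B (?B (T 0 x 0) (T 0 y 0)) (T 0 0 z) + ?B (?B (T 0 y 0) (T 0 0 z)) (T 0 x 0)
        + ?B (?B (T 0 0 z) (T 0 x 0)) (T 0 y 0)) Iv = 0"
      using jac[of 0 x 0 0 y 0 0 0 z] by simp
    then have eq: "- scale (1/3) (act (b y z) x)
        = scale (1/3) (act (b z x) y) + scale (1/9) (p (p x y) z)"
      by (simp only: box_T lin mult_0 c0.zero c2.zero diff_0 diff_0_right add_0_left add_0_right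
          scale_zero_right minus_zero)
        (simp add: T_def c2.add c2.scale c2.diff c2.neg c2_act c2_p algebra_simps)
    have "scale (1/3) (scale (1/3) (p (p x y) z) + act (b y z) x + act (b z x) y)
        = scale (1/3) (act (b y z) x) + (scale (1/3) (act (b z x) y) + scale (1/9) (p (p x y) z))"
      by (simp add: algebra_simps)
    also have "\<dots> = 0" unfolding eq[symmetric] by simp
    finally have "scale (1/3) (scale (1/3) (p (p x y) z) + act (b y z) x + act (b z x) y) = 0" .
    then have "scale 3 (scale (1/3) (p (p x y) z) + act (b y z) x + act (b z x) y) = 0"
      using three by simp
    then have "p (p x y) z + scale 3 (act (b y z) x + act (b z x) y) = 0"
      using three by (simp add: scale_right_distrib add.assoc)
    then show ?thesis by (rule eq_neg_iff_add_eq_0[THEN iffD2])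
  qed
  have P: "p (p x y) z - p (p y z) x - p (p z x) y = scale 6 (act (b x y) z)" for x y z
  proof -
    have "p (p x y) z - p (p y z) x - p (p z x) y = scale (3 + 3) (act (b x y) z)"
      unfolding pp scale_left_distrib scale_right_distrib by (simp add: algebra_simps)
    then show ?thesis by simp
  qed
  have malcev: "p (p (p x y) z) x + p (p (p y z) x) x + p (p (p z x) x) y = p (p x z) (p y x)"
    for x y z
  proof (rule malcev_identity_of_derivations)
    show "x = 0" if "x + x + x = 0" for x :: 'm
    proof -
      have "scale 3 x = scale (1 + 1 + 1) x" by simp
      also have "\<dots> = 0" using that by (simp only: scale_left_distrib scale_one)
      finally show ?thesis using three by simp
    qed
  \<comment> \<open>By \<open>P\<close>, the required derivation rule is \<open>act_deriv\<close>
    for \<open>b x y\<close>, scaled by 6.\<close>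
  qed (simp_all only: P alt p_addl p_addr act_deriv p_scl p_scr scale_right_distrib)
  have p_eq: "c2 (mult x y) = p x y" if "x \<in> M2" "y \<in> M2" for x y
    using that by (simp add: p_def c2_id)
  have p_in: "p x y \<in> M2" for x y unfolding p_def by (rule c2_in)
  show ?thesis
    unfolding malcev_algebra_on_def algebra_on_def c2_def[symmetric]
  proof (intro conjI ballI allI)
    fix x y z c assume x: "x \<in> M2" and y: "y \<in> M2" and z: "z \<in> M2"
    show "c2 (mult x y) = - c2 (mult y x)" using anti[of x y] x y by (simp add: p_eq)
    show "c2 (mult (c2 (mult (c2 (mult x y)) z)) x) + c2 (mult (c2 (mult (c2 (mult y z)) x)) x)
        + c2 (mult (c2 (mult (c2 (mult z x)) x)) y) = c2 (mult (c2 (mult x z)) (c2 (mult y x)))"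
      using malcev[of x y z] x y z by (simp only: p_eq p_in)
  qed (simp_all add: V sub c2_in mult_simps c2.add c2.scale)
qed

end
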